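(* Let $T>0$, let $\varphi$ be a $T$-periodic z-c function with zeros $t_1^o<\dots<t_{m_o}^o<t_1^o+T$ in one period, and let $\mathbf{L}$ be an admissible operator. Let $\mu_c>0$ be such that for every $\mu\in[0,\mu_c)$ the equation $$f(t)=\varphi(t)-\mu\,\bigl(\mathbf{L}(\operatorname{sign} f)\bigr)(t)$$ has a $T$-periodic z-c solution $f=f_\mu$ possessing the z-c features of $\varphi$, with correspondingly labelled zeros $t_1(\mu)<\dots<t_{m_o}(\mu)<t_1(\mu)+T$, where each $t_k(\cdot)$ is continuous on $[0,\mu_c)$, differentiable on $(0,\mu_c)$, and $t_k(0)=t_k^o$. Fix a constant $A>0$, and for $U>A/\mu_c$ put $\mu=A/U$, $i(t)=Uf_\mu(t)$, $v(t)=A\operatorname{sign} i(t)$ and $P(U)=\langle i\,v\rangle$. Let $$K_U(\mu)=\frac{d\ln P}{d\ln U}\Big|_{U=A/\mu},\qquad 0<\mu<\mu_c .$$ Then $K_U(\mu)\ge 1$ for all $\mu\in(0,\mu_c)$, and $K_U(\mu)\equiv 1$ on $(0,\mu_c)$ if and only if all $t_k$ are constant, i.e. $t_k(\mu)=t_k^o$ for all $k$ and all $\mu\in[0,\mu_c)$.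
   Context: All functions are real-valued, $\omega=2\pi/T$, $\langle g\rangle=\frac1T\int_0^T g(t)\,dt$, and $\operatorname{sign}0=0$. A $T$-periodic z-c function is a continuous, piecewise $C^1$, $T$-periodic function, not identically zero, with zero average, all of whose zeros are zero-crossings (z-cs): isolated simple zeros $t_*$ at which the two one-sided derivatives are nonzero and have the same sign. Such a function has a finite even number $m\ge 2$ of zeros per period and changes sign at each of them. Let $\varphi$ be a $T$-periodic z-c function with zeros $t_1^o<t_2^o<\dots<t_{m_o}^o<t_1^o+T=:t_{m_o+1}^o$ in one period. A $T$-periodic function $f$ possesses the z-c features of $\varphi$ if $f$ is a $T$-periodic z-c function with exactly $m_o$ zeros per period, which can be labelled $t_1<\dots<t_{m_o}<t_1+T=:t_{m_o+1}$ so that for each $k=1,\dots,m_o$ the sign of $f$ on $(t_k,t_{k+1})$ equals the sign of $\varphi$ on $(t_k^o,t_{k+1}^o)$. An admissible operator $\mathbf{L}$ is the steady-state response operator of a linear time-invariant lossless system (convolution with a real kernel), acting on bounded measurable $T$-periodic functions $\zeta=\sum_n\zeta_n e^{in\omega t}$ as the Fourier multiplier $(\mathbf{L}\zeta)_n=\ell(n\omega)\,\zeta_n$, where $\ell$ is the frequency response, $\ell(-\Omega)=\overline{\ell(\Omega)}$, finite at every $\Omega=n\omega$ (no resonance), and: (i) $\mathbf{L}(1)=0$, i.e. $\ell(0)=0$, so that $\mathbf{L}\zeta$ always has zero average; (ii) there are $L_o>0$ and $d\ge2$ with $i\Omega\,\ell(\Omega)-1/L_o=O(|\Omega|^{-d})$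 as $|\Omega|\to\infty$; (iii) $\langle\zeta\,\mathbf{L}\zeta\rangle=0$ for every bounded $T$-periodic $\zeta$. Equivalent forms: $P=AU\,\eta(\mu)$ with $\eta(\mu)=\langle|f_\mu|\rangle=\langle\varphi\operatorname{sign}f_\mu\rangle>0$, and $K_U(\mu)=1-\frac{\mu}{\eta}\frac{d\eta}{d\mu}$. *)

theory Defs
  imports "HOL-Analysis.Analysis" "HOL-Library.Landau_Symbols"
begin

definition periodic :: "real \<Rightarrow> (real \<Rightarrow> 'a) \<Rightarrow> bool" where
  "periodic T g \<longleftrightarrow> (\<forall>s. g (s + T) = g s)"

definition period_avg :: "real \<Rightarrow> (real \<Rightarrow> 'a::real_normed_vector) \<Rightarrow> 'a" where
  "period_avg T g = (1 / T) *\<^sub>R integral {0..T} g"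

(* The library notion alone does not ask the derivative to have one-sided limits
   at the exceptional points. *)
definition piecewise_C1_periodic :: "real \<Rightarrow> (real \<Rightarrow> real) \<Rightarrow> bool" where
  "piecewise_C1_periodic T g \<longleftrightarrow>
     g piecewise_C1_differentiable_on {0..T} \<and>
     (\<forall>s. (\<exists>l. (deriv g \<longlongrightarrow> l) (at_left s)) \<and> (\<exists>r. (deriv g \<longlongrightarrow> r) (at_right s)))"

definition zero_crossing :: "(real \<Rightarrow> real) \<Rightarrow> real \<Rightarrow> bool" where
  "zero_crossing g s \<longleftrightarrow>
     g s = 0 \<and> (\<forall>\<^sub>F x in at s. g x \<noteq> 0) \<and>
     (\<exists>a b. (g has_real_derivative a) (at_left s) \<and> (g has_real_derivative b) (at_right s) \<and>
            a \<noteq> 0 \<and> b \<noteq> 0 \<and> sgn a = sgn b)"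

definition zc_function :: "real \<Rightarrow> (real \<Rightarrow> real) \<Rightarrow> bool" where
  "zc_function T g \<longleftrightarrow>
     continuous_on UNIV g \<and> piecewise_C1_periodic T g \<and> periodic T g \<and>
     (\<exists>s. g s \<noteq> 0) \<and> period_avg T g = 0 \<and>
     (\<forall>s. g s = 0 \<longrightarrow> zero_crossing g s)"

(* t 1 < ... < t m are the zeros of g in the period [t 1, t 1 + T);
   t (m + 1) is merely a name for t 1 + T. *)
definition zero_labelling :: "real \<Rightarrow> (real \<Rightarrow> real) \<Rightarrow> nat \<Rightarrow> (nat \<Rightarrow> real) \<Rightarrow> bool" where
  "zero_labelling T g m t \<longleftrightarrow>
     t (m + 1) = t 1 + T \<and> strict_mono_on {1..m + 1} t \<and>
     {s \<in> {t 1..<t 1 + T}. g s = 0} = t ` {1..m}"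

(* g possesses the z-c features of \<phi>, whose m zeros per period are labelled by t0,
   and t is a corresponding labelling of the zeros of g. *)
definition zc_features ::
  "real \<Rightarrow> (real \<Rightarrow> real) \<Rightarrow> nat \<Rightarrow> (nat \<Rightarrow> real) \<Rightarrow> (real \<Rightarrow> real) \<Rightarrow> (nat \<Rightarrow> real) \<Rightarrow> bool" where
  "zc_features T \<phi> m t0 g t \<longleftrightarrow>
     zc_function T g \<and> zero_labelling T g m t \<and>
     (\<forall>k\<in>{1..m}. \<forall>s\<in>{t k<..<t (k + 1)}. \<forall>s0\<in>{t0 k<..<t0 (k + 1)}. sgn (g s) = sgn (\<phi> s0))"

definition periodic_input :: "real \<Rightarrow> (real \<Rightarrow> real) \<Rightarrow> bool" where
  "periodic_input T \<zeta> \<longleftrightarrow>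
     periodic T \<zeta> \<and> bounded (range \<zeta>) \<and> \<zeta> \<in> borel_measurable lebesgue"

definition fourier_coeff :: "real \<Rightarrow> (real \<Rightarrow> real) \<Rightarrow> int \<Rightarrow> complex" where
  "fourier_coeff T \<zeta> n =
     period_avg T (\<lambda>s. complex_of_real (\<zeta> s) * cis (- (of_int n * (2 * pi / T) * s)))"

(* l is the frequency response.  By the decay condition l is O(1/|Omega|), so the response to
   a periodic input has an absolutely convergent Fourier series; since Fourier coefficients
   fix a function only almost everywhere, the response is taken to be its continuous sum. The
   symmetry of l expresses that the convolution kernel is real. *)
definition admissible_operator :: "real \<Rightarrow> ((real \<Rightarrow> real) \<Rightarrow> (real \<Rightarrow> real)) \<Rightarrow> bool" where
  "admissible_operator T L \<longleftrightarrow>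
     (\<exists>l :: real \<Rightarrow> complex.
        (\<forall>\<Omega>. l (- \<Omega>) = cnj (l \<Omega>)) \<and>
        (\<forall>\<zeta>. periodic_input T \<zeta> \<longrightarrow>
           continuous_on UNIV (L \<zeta>) \<and> periodic T (L \<zeta>) \<and>
           (\<forall>n. fourier_coeff T (L \<zeta>) n = l (of_int n * (2 * pi / T)) * fourier_coeff T \<zeta> n)) \<and>
        l 0 = 0 \<and>
        (\<exists>L0 > 0. \<exists>d \<ge> 2. (\<lambda>\<Omega>. cmod (\<i> * of_real \<Omega> * l \<Omega> - of_real (1 / L0)))
                             \<in> O[at_infinity](\<lambda>\<Omega>. \<bar>\<Omega>\<bar> powr (- d)))) \<and>
     (\<forall>\<zeta>. periodic_input T \<zeta> \<longrightarrow> period_avg T (\<lambda>s. \<zeta> s * L \<zeta> s) = 0)"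

definition current :: "real \<Rightarrow> (real \<Rightarrow> real \<Rightarrow> real) \<Rightarrow> real \<Rightarrow> real \<Rightarrow> real" where
  "current A f U s = U * f (A / U) s"

definition voltage :: "real \<Rightarrow> (real \<Rightarrow> real \<Rightarrow> real) \<Rightarrow> real \<Rightarrow> real \<Rightarrow> real" where
  "voltage A f U s = A * sgn (current A f U s)"

definition mean_power :: "real \<Rightarrow> real \<Rightarrow> (real \<Rightarrow> real \<Rightarrow> real) \<Rightarrow> real \<Rightarrow> real" where
  "mean_power T A f U = period_avg T (\<lambda>s. current A f U s * voltage A f U s)"

(* ln P as a function of x = ln U; its derivative at x = ln U is d ln P / d ln U. *)
definition log_power :: "real \<Rightarrow> real \<Rightarrow> (real \<Rightarrow> real \<Rightarrow> real) \<Rightarrow> real \<Rightarrow> real" where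
  "log_power T A f x = ln (mean_power T A f (exp x))"

definition K_U :: "real \<Rightarrow> real \<Rightarrow> (real \<Rightarrow> real \<Rightarrow> real) \<Rightarrow> real \<Rightarrow> real" where
  "K_U T A f \<mu> = deriv (log_power T A f) (ln (A / \<mu>))"

end

theory Submission
  imports Defs "HOL-Library.Periodic_Fun"
begin

text \<open>Write \<open>\<zeta> \<mu> = sign f\<^sub>\<mu>\<close> and \<open>\<eta>(\<mu>) = \<langle>|f\<^sub>\<mu>|\<rangle>\<close>, so that \<open>P = AU \<eta>(A/U)\<close> and \<open>K\<^sub>U = 1 - \<mu> \<eta>'/\<eta>\<close>;
  the theorem says that \<open>\<eta>\<close> is nonincreasing, and constant only if the zeros stay put. No differentiation of
  the equation is needed. Losslessness makes \<open>\<langle>\<zeta> L \<xi>\<rangle>\<close> antisymmetric, and testing the equation at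
  \<open>\<mu>\<close> with \<open>\<zeta> \<nu>\<close> and vice versa gives, for \<open>\<mu> < \<nu>\<close>,
  \<open>\<eta>(\<nu>) \<le> \<eta>(\<mu>) - \<langle>|f\<^sub>\<mu>| - f\<^sub>\<mu> sign f\<^sub>\<nu>\<rangle>\<close>, where the average is nonnegative. If \<open>\<eta>\<close> is constant, this
  average vanishes, hence every zero of \<open>f\<^sub>\<nu>\<close> is one of \<open>f\<^sub>\<mu>\<close>, and the continuous \<open>t\<^sub>k\<close> move in a
  discrete set. Conversely \<open>\<eta>\<close> depends on \<open>\<mu>\<close> only through the \<open>t\<^sub>k\<close>, since \<open>\<eta>(\<mu>) = \<langle>\<phi> sign f\<^sub>\<mu>\<rangle>\<close>,
  which also gives its differentiability.\<close>

section \<open>Periodic inputs and their averages\<close>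

lemma periodic_plus_of_int:
  assumes "periodic T g"
  shows "g (s + of_int n * T) = g s"
proof -
  interpret periodic_fun_simple g T
    using assms by unfold_locales (simp add: periodic_def)
  show ?thesis by (rule plus_of_int)
qed

lemma periodic_reduce:
  assumes "periodic T g" and "T > 0"
  obtains s' where "s' \<in> {0..<T}" and "g s = g s'"
proof
  define n where "n = \<lfloor>s / T\<rfloor>"
  have "of_int n \<le> s / T" and "s / T < of_int n + 1"
    unfolding n_def by linarith+
  then show "s + of_int (- n) * T \<in> {0..<T}"
    using \<open>T > 0\<close> by (simp add: field_simps)
  show "g s = g (s + of_int (- n) * T)"
    using periodic_plus_of_int[OF assms(1)] by metis
qed

lemma integral_periodic_shift:
  fixes g :: "real \<Rightarrow> real"
  assumes per: "periodic T g" and T: "T > 0" and int: "\<And>a b. g integrable_on {a..b}"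
  shows "integral {a..a + T} g = integral {0..T} g"
proof -
  have shift: "integral {u + of_int n * T..v + of_int n * T} g = integral {u..v} g" for u v n
  proof -
    have "integral {u..v} g = integral {u + of_int n * T - of_int n * T..v + of_int n * T - of_int n * T}
        (\<lambda>s. g (s + of_int n * T))"
      by (simp add: periodic_plus_of_int[OF per])
    then show ?thesis
      by (simp only: integral_shift_real_ivl)
  qed
  \<comment> \<open>Here the window leaves \<open>{0..T}\<close> by \<open>{T..a + T}\<close>, the
    translate of the missing piece \<open>{0..a}\<close>. Any other \<open>a\<close> is brought into
    this range by whole periods.\<close>
  have *: "integral {a..a + T} g = integral {0..T} g" if "0 \<le> a" "a \<le> T" for a
  proof -
    have "integral {0..a} g + integral {a..T} g = integral {0..T} g"
         "integral {a..T} g + integral {T..a + T} g = integral {a..a + T} g"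
      using that T int Henstock_Kurzweil_Integration.integral_combine[where f = g and a = 0 and c = a and b = T] Henstock_Kurzweil_Integration.integral_combine[where f = g and a = a and c = T and b = "a + T"] by auto
    then show ?thesis
      using shift[of 0 1 a] by simp
  qed
  define n where "n = \<lfloor>a / T\<rfloor>"
  have "of_int n \<le> a / T" "a / T < of_int n + 1"
    unfolding n_def by linarith+
  then have "0 \<le> a - of_int n * T" "a - of_int n * T \<le> T"
    using T by (auto simp: field_simps)
  from *[OF this] show ?thesis
    using shift[of "a - of_int n * T" n "a - of_int n * T + T"] by (simp add: algebra_simps)
qed

lemma periodic_input_bound:
  assumes "periodic_input T \<zeta>"
  obtains B where "\<And>s. \<bar>\<zeta> s\<bar> \<le> B"
  using assms unfolding periodic_input_def bounded_iff by auto

lemma periodic_inputI: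
  assumes "periodic T \<zeta>" and "\<zeta> \<in> borel_measurable lebesgue" and "\<And>s. \<bar>\<zeta> s\<bar> \<le> B"
  shows "periodic_input T \<zeta>"
  using assms unfolding periodic_input_def bounded_iff by auto

lemma periodic_input_add:
  assumes "periodic_input T \<zeta>" "periodic_input T \<xi>"
  shows "periodic_input T (\<lambda>s. \<zeta> s + \<xi> s)"
proof -
  obtain B C where "\<And>s. \<bar>\<zeta> s\<bar> \<le> B" "\<And>s. \<bar>\<xi> s\<bar> \<le> C"
    using assms by (meson periodic_input_bound)
  then have "\<bar>\<zeta> s + \<xi> s\<bar> \<le> B + C" for s
    by (meson abs_triangle_ineq add_mono order_trans)
  then show ?thesis
    using assms by (intro periodic_inputI) (auto simp: periodic_input_def periodic_def)
qed

lemma periodic_input_mult: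
  assumes "periodic_input T \<zeta>" "periodic_input T \<xi>"
  shows "periodic_input T (\<lambda>s. \<zeta> s * \<xi> s)"
proof -
  obtain B C where "\<And>s. \<bar>\<zeta> s\<bar> \<le> B" "\<And>s. \<bar>\<xi> s\<bar> \<le> C"
    using assms by (meson periodic_input_bound)
  then have "\<bar>\<zeta> s * \<xi> s\<bar> \<le> B * C" for s
    unfolding abs_mult by (intro mult_mono) (auto intro: order_trans[OF abs_ge_zero])
  then show ?thesis
    using assms by (intro periodic_inputI) (auto simp: periodic_input_def periodic_def)
qed

lemma periodic_input_const: "periodic_input T (\<lambda>s. c)"
  by (rule periodic_inputI) (auto simp: periodic_def)

lemma periodic_input_cmult: "periodic_input T \<zeta> \<Longrightarrow> periodic_input T (\<lambda>s. c * \<zeta> s)"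
  by (intro periodic_input_mult periodic_input_const)

lemma periodic_input_diff:
  assumes "periodic_input T \<zeta>" "periodic_input T \<xi>"
  shows "periodic_input T (\<lambda>s. \<zeta> s - \<xi> s)"
  using periodic_input_add[OF assms(1) periodic_input_cmult[OF assms(2), of "-1"]] by simp

text \<open>Boundedness comes from compactness: by periodicity every value already occurs on
  \<open>{0..T}\<close>.\<close>

lemma periodic_input_continuous:
  assumes "T > 0" "continuous_on UNIV g" "periodic T g"
  shows "periodic_input T g"
proof -
  have "range g \<subseteq> g ` {0..T}"
  proof safe
    fix s show "g s \<in> g ` {0..T}"
      using periodic_reduce[OF assms(3,1), of s] by (metis atLeastAtMost_iff atLeastLessThan_iff image_eqI less_imp_le)
  qed
  moreover have "bounded (g ` {0..T})"
    using assms(2) by (intro compact_imp_bounded compact_continuous_image) (auto intro: continuous_on_subset)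
  ultimately have "bounded (range g)" by (rule bounded_subset[rotated])
  moreover have "g \<in> borel_measurable lebesgue"
    using borel_measurable_continuous_onI[OF assms(2)] by (intro measurable_completion) simp
  ultimately show ?thesis using assms(3) by (simp add: periodic_input_def)
qed

lemma periodic_input_sgn:
  fixes g :: "real \<Rightarrow> real"
  assumes "continuous_on UNIV g" "periodic T g"
  shows "periodic_input T (\<lambda>s. sgn (g s))"
proof (rule periodic_inputI)
  have "g \<in> borel_measurable lborel"
    using borel_measurable_continuous_onI[OF assms(1)] by simp
  then show "(\<lambda>s. sgn (g s)) \<in> borel_measurable lebesgue"
    by (intro measurable_completion) (simp add: borel_measurable_sgn measurable_compose[of g _ _ sgn])
  show "\<bar>sgn (g s)\<bar> \<le> 1" for s by (simp add: abs_sgn_eq)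
qed (use assms(2) in \<open>simp add: periodic_def\<close>)

text \<open>General in the codomain because the integrands of Fourier coefficients are
  complex.\<close>

lemma bounded_measurable_integrable_on:
  fixes g :: "real \<Rightarrow> 'a::euclidean_space"
  assumes "g \<in> borel_measurable lebesgue" and "\<And>s. norm (g s) \<le> B"
  shows "g integrable_on {a..b}"
proof (rule measurable_bounded_by_integrable_imp_integrable)
  show "g \<in> borel_measurable (lebesgue_on {a..b})"
    using assms(1) by (rule measurable_restrict_space1)
  show "(\<lambda>s. B) integrable_on {a..b}" by (rule integrable_const_ivl)
qed (use assms(2) in auto)

lemma periodic_input_integrable:
  assumes "periodic_input T \<zeta>"
  shows "\<zeta> integrable_on {a..b}"
proof -
  obtain B where "\<And>s. \<bar>\<zeta> s\<bar> \<le> B" using assms by (meson periodic_input_bound)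
  then show ?thesis
    using assms by (intro bounded_measurable_integrable_on) (auto simp: periodic_input_def)
qed

lemma period_avg_add:
  assumes "periodic_input T \<zeta>" "periodic_input T \<xi>"
  shows "period_avg T (\<lambda>s. \<zeta> s + \<xi> s) = period_avg T \<zeta> + period_avg T \<xi>"
  unfolding period_avg_def
  by (subst integral_add) (auto intro: periodic_input_integrable[OF assms(1)]
      periodic_input_integrable[OF assms(2)] simp: algebra_simps)

lemma period_avg_cmult:
  fixes g :: "real \<Rightarrow> real"
  shows "period_avg T (\<lambda>s. c * g s) = c * period_avg T g"
  by (simp add: period_avg_def)

lemma period_avg_diff:
  assumes "periodic_input T \<zeta>" "periodic_input T \<xi>"
  shows "period_avg T (\<lambda>s. \<zeta> s - \<xi> s) = period_avg T \<zeta> - period_avg T \<xi>"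
  using period_avg_add[OF assms(1) periodic_input_cmult[OF assms(2), of "-1"]]
    period_avg_cmult[of T "-1" \<xi>] by simp


section \<open>Uniqueness of Fourier coefficients\<close>

text \<open>Moves \<open>g\<close> to the compact circle, where Stone-Weierstrass applies.
  Continuity is the only issue: \<open>Arg\<close> jumps across the negative real axis, but
  \<open>Arg2pi\<close> is continuous there, and by periodicity \<open>g\<close> takes the same
  value at both arguments.\<close>

lemma continuous_on_sphere_unroll:
  fixes g :: "real \<Rightarrow> real"
  assumes per: "periodic (2 * pi) g" and cont: "continuous_on UNIV g"
  obtains h where "continuous_on (sphere 0 1) h" and "\<And>x. h (cis x) = g x"
proof
  define h where "h z = g (Arg z)" for z
  have g_Arg: "g a = g b" if "cis a = cis b" for a b
  proof -
    have "exp (\<i> * of_real a) = exp (\<i> * of_real b)"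
      using that by (simp add: cis_conv_exp)
    then obtain n :: int where "\<i> * of_real a = \<i> * of_real b + of_int (2 * n) * of_real pi * \<i>"
      by (auto simp: exp_eq)
    then have "a = b + of_int n * (2 * pi)"
      by (auto simp: complex_eq_iff)
    then show ?thesis using periodic_plus_of_int[OF per] by simp
  qed
  have cis_Arg2pi: "cis (Arg2pi z) = cis (Arg z)" if "z \<noteq> 0" for z
  proof -
    have "of_real (norm z) * cis (Arg2pi z) = of_real (norm z) * cis (Arg z)"
      using that Arg2pi_eq[of z] Arg_eq[of z] by (simp add: cis_conv_exp)
    then show ?thesis using that by simp
  qed
  have "isCont h z" if "z \<in> sphere 0 1" for z
  proof -
    have gc: "isCont g y" for y
      using cont by (simp add: continuous_on_eq_continuous_at)
    have z: "z \<noteq> 0" using that by auto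
    show ?thesis
    proof (cases "z \<in> \<real>\<^sub>\<le>\<^sub>0")
      case False
      then show ?thesis unfolding h_def
        by (rule isCont_o2[OF continuous_at_Arg gc])
    next
      case True
      with z have "z \<notin> \<real>\<^sub>\<ge>\<^sub>0"
        by (auto simp: complex_nonpos_Reals_iff complex_nonneg_Reals_iff complex_eq_iff)
      then have "isCont (\<lambda>z. g (Arg2pi z)) z"
        by (rule isCont_o2[OF continuous_at_Arg2pi gc])
      moreover have "\<forall>\<^sub>F w in nhds z. h w = g (Arg2pi w)"
        using t1_space_nhds[OF z] by eventually_elim (auto simp: h_def intro: g_Arg cis_Arg2pi[symmetric])
      ultimately show ?thesis by (simp add: isCont_cong)
    qed
  qed
  then show "continuous_on (sphere 0 1) h"
    by (simp add: continuous_at_imp_continuous_on)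
  show "h (cis x) = g x" for x
    unfolding h_def by (rule g_Arg) (simp add: cis_Arg sgn_div_norm)
qed

text \<open>All integer frequencies are taken at once so that the property survives multiplication
  by a character; continuity is carried along so that the integral of a sum can be split.\<close>

definition cis_orthogonal :: "(real \<Rightarrow> complex) \<Rightarrow> bool" where
  "cis_orthogonal k \<longleftrightarrow> continuous_on {0..2 * pi} k \<and>
     (\<forall>n::int. integral {0..2 * pi} (\<lambda>x. k x * cis (of_int n * x)) = 0)"

lemma cis_orthogonal_add:
  assumes "cis_orthogonal k" "cis_orthogonal k'"
  shows "cis_orthogonal (\<lambda>x. k x + k' x)"
proof -
  have "(\<lambda>x. k x * cis (of_int n * x)) integrable_on {0..2 * pi}"
       "(\<lambda>x. k' x * cis (of_int n * x)) integrable_on {0..2 * pi}" for n :: int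
    using assms unfolding cis_orthogonal_def
    by (auto intro!: integrable_continuous_real continuous_intros)
  then show ?thesis
    using assms by (auto simp: cis_orthogonal_def algebra_simps integral_add intro!: continuous_intros)
qed

lemma cis_orthogonal_cmult:
  assumes "cis_orthogonal k" shows "cis_orthogonal (\<lambda>x. c * k x)"
  using assms by (auto simp: cis_orthogonal_def mult.assoc intro!: continuous_intros)

text \<open>Multiplication by a character merely shifts the frequency index by
  \<open>j\<close>.\<close>

lemma cis_orthogonal_shift:
  assumes "cis_orthogonal k" shows "cis_orthogonal (\<lambda>x. cis (of_int j * x) * k x)"
proof -
  have "cis (of_int j * x) * k x * cis (of_int n * x) = k x * cis (of_int (j + n) * x)" for n :: int and x
  proof -
    have "cis (of_int (j + n) * x) = cis (of_int j * x) * cis (of_int n * x)"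
      by (simp add: cis_mult algebra_simps)
    then show ?thesis by (simp only: mult_ac)
  qed
  then show ?thesis
    using assms unfolding cis_orthogonal_def
    by (simp only:) (auto intro!: continuous_intros)
qed

text \<open>On the circle a polynomial is a trigonometric polynomial. The function \<open>k\<close>
  is arbitrary in the induction so that a product is handled by feeding the result for
  \<open>q\<close> into the hypothesis for \<open>p\<close>.\<close>

lemma cis_orthogonal_polynomial:
  assumes "real_polynomial_function p" and "cis_orthogonal k"
  shows "cis_orthogonal (\<lambda>x. of_real (p (cis x)) * k x)"
  using assms
proof (induction arbitrary: k)
  case (linear p)
  interpret bounded_linear p by fact
  \<comment> \<open>\<open>c\<close> and \<open>d\<close> are the coefficients of
    \<open>cis x\<close> and \<open>cis (- x)\<close> when Euler's formulas are inserted into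
    \<open>cos x * p 1 + sin x * p \<i>\<close>.\<close>
  define c where "c = (of_real (p 1) - \<i> * of_real (p \<i>)) / 2"
  define d where "d = (of_real (p 1) + \<i> * of_real (p \<i>)) / 2"
  have "of_real (p (cis x)) * k x = c * (cis (of_int 1 * x) * k x) + d * (cis (of_int (-1) * x) * k x)" for x
  proof -
    have "cis x = cos x *\<^sub>R 1 + sin x *\<^sub>R \<i>" by (simp add: complex_eq_iff)
    then have "p (cis x) = cos x * p 1 + sin x * p \<i>" by (metis add scale real_scaleR_def)
    then have "of_real (p (cis x)) = c * cis x + d * cis (- x)"
      by (simp add: c_def d_def complex_eq_iff field_simps)
    then show ?thesis by (simp add: algebra_simps)
  qed
  moreover have "cis_orthogonal (\<lambda>x. c * (cis (of_int 1 * x) * k x) + d * (cis (of_int (-1) * x) * k x))"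
    using linear.prems by (intro cis_orthogonal_add cis_orthogonal_cmult cis_orthogonal_shift)
  ultimately show ?case by presburger
next
  case (const c)
  then show ?case by (rule cis_orthogonal_cmult)
next
  case (add p q)
  then show ?case
    using cis_orthogonal_add[OF add.IH(1) add.IH(2), OF add.prems add.prems] by (simp add: algebra_simps)
next
  case (mult p q)
  then show ?case
    using mult.IH(1)[OF mult.IH(2), OF mult.prems] by (simp add: algebra_simps)
qed

text \<open>Approximate \<open>g\<close> uniformly within \<open>e\<close> by a polynomial on the
  circle. That polynomial is orthogonal to \<open>g\<close>, so subtracting it does not change the
  integral of \<open>g x * g x\<close>, which is therefore at most \<open>e\<close> times the
  integral of \<open>\<bar>g x\<bar>\<close>.\<close>

lemma cis_orthogonal_imp_zero:
  fixes g :: "real \<Rightarrow> real"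
  assumes per: "periodic (2 * pi) g" and cont: "continuous_on UNIV g"
    and orth: "\<And>n::int. integral {0..2 * pi} (\<lambda>x. of_real (g x) * cis (of_int n * x)) = 0"
  shows "g x = 0"
proof -
  have cont': "continuous_on {0..2 * pi} g" using cont by (rule continuous_on_subset) simp
  obtain h where h: "continuous_on (sphere 0 1) h" "\<And>x. h (cis x) = g x"
    using continuous_on_sphere_unroll[OF per cont] by blast
  define I where "I = integral {0..2 * pi} (\<lambda>x. \<bar>g x\<bar>)"
  have "I \<ge> 0" unfolding I_def
    by (intro integral_nonneg integrable_continuous_real continuous_intros cont') auto
  define J where "J = integral {0..2 * pi} (\<lambda>x. g x * g x)"
  have J: "J \<le> e * I" if "e > 0" for e
  proof -
    obtain p where p: "real_polynomial_function p" "\<And>z. z \<in> sphere 0 1 \<Longrightarrow> \<bar>h z - p z\<bar> < e"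
      using Stone_Weierstrass_real_polynomial_function[OF compact_sphere h(1) \<open>e > 0\<close>] by metis
    have pc: "continuous_on {0..2 * pi} (\<lambda>x. p (cis x))"
      using p(1) by (intro continuous_on_compose2[OF continuous_on_polymonial_function[of p UNIV]] continuous_intros)
         (auto simp: real_polynomial_function_eq)
    have "cis_orthogonal (\<lambda>x. of_real (g x))"
      using orth cont' by (auto simp: cis_orthogonal_def intro!: continuous_intros)
    \<comment> \<open>Orthogonality is read off at frequency 0, where the character is constantly
      1.\<close>
    from cis_orthogonal_polynomial[OF p(1) this]
    have "integral {0..2 * pi} (\<lambda>x. complex_of_real (p (cis x) * g x)) = 0"
      unfolding cis_orthogonal_def by (auto dest: spec[of _ 0])
    moreover have "(\<lambda>x. p (cis x) * g x) integrable_on {0..2 * pi}"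
      by (intro integrable_continuous_real continuous_intros cont' pc)
    from integral_linear[OF this bounded_linear_of_real[where 'a = complex]]
    have "integral {0..2 * pi} (\<lambda>x. complex_of_real (p (cis x) * g x)) =
        of_real (integral {0..2 * pi} (\<lambda>x. p (cis x) * g x))"
      by (simp add: o_def)
    ultimately have 0: "integral {0..2 * pi} (\<lambda>x. p (cis x) * g x) = 0"
      by simp
    have "J = integral {0..2 * pi} (\<lambda>x. g x * g x - p (cis x) * g x)"
      unfolding J_def using 0
      by (subst integral_diff) (auto intro!: integrable_continuous_real continuous_intros cont' pc)
    also have "\<dots> \<le> integral {0..2 * pi} (\<lambda>x. e * \<bar>g x\<bar>)"
    proof (intro integral_le)
      fix x
      have "\<bar>g x - p (cis x)\<bar> \<le> e" using p(2)[of "cis x"] h(2)[of x] by simp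
      then have "(g x - p (cis x)) * g x \<le> e * \<bar>g x\<bar>"
        by (metis abs_ge_self abs_ge_zero abs_mult mult_right_mono order_trans)
      then show "g x * g x - p (cis x) * g x \<le> e * \<bar>g x\<bar>" by (simp add: algebra_simps)
    qed (intro integrable_continuous_real continuous_intros cont' pc)+
    also have "\<dots> = e * I" by (simp add: I_def)
    finally show ?thesis .
  qed
  have "J \<le> 0"
  proof (rule field_le_epsilon)
    fix e :: real assume "e > 0"
    \<comment> \<open>Dividing by \<open>I + 1\<close> instead of \<open>I\<close> keeps the choice
      legitimate when \<open>I = 0\<close>.\<close>
    have "J \<le> e / (I + 1) * I" using \<open>e > 0\<close> \<open>I \<ge> 0\<close> by (intro J) simp
    also have "\<dots> \<le> e" using \<open>e > 0\<close> \<open>I \<ge> 0\<close> by (simp add: field_simps)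
    finally show "J \<le> 0 + e" by simp
  qed
  moreover have "J \<ge> 0" unfolding J_def
    by (intro integral_nonneg integrable_continuous_real continuous_intros cont') auto
  ultimately have "integral {0..2 * pi} (\<lambda>x. g x * g x) = 0" by (simp add: J_def)
  then have "\<forall>x\<in>{0..2 * pi}. g x * g x = 0"
    by (subst (asm) integral_eq_0_iff) (auto intro!: continuous_intros cont')
  then show ?thesis
    using periodic_reduce[OF per, of x] by auto
qed

text \<open>The stretch by \<open>c = T / (2 * pi)\<close> reduces this to period
  \<open>2 * pi\<close>. Continuity is what yields vanishing everywhere rather than almost
  everywhere.\<close>

lemma fourier_coeff_zero_imp_zero:
  assumes "T > 0" and per: "periodic T g" and cont: "continuous_on UNIV g"
    and zero: "\<And>n. fourier_coeff T g n = 0"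
  shows "g s = 0"
proof -
  define c where "c = T / (2 * pi)"
  have c: "c > 0" using \<open>T > 0\<close> by (simp add: c_def)
  have T: "T = c * (2 * pi)" by (simp add: c_def)
  have "g (c * x) = 0" for x
  proof (rule cis_orthogonal_imp_zero[where g = "\<lambda>x. g (c * x)"])
    show "periodic (2 * pi) (\<lambda>x. g (c * x))"
      using per by (simp add: periodic_def T algebra_simps)
    show "continuous_on UNIV (\<lambda>x. g (c * x))"
      by (intro continuous_on_compose2[OF cont] continuous_intros) auto
    fix n :: int
    define k where "k s = of_real (g s) * cis (of_int n * (s / c))" for s
    \<comment> \<open>The exponent in \<open>fourier_coeff\<close> carries a minus sign, hence the
      coefficient with index \<open>-n\<close>.\<close>
    have "integral {0..T} (\<lambda>s. of_real (g s) * cis (- (of_int (- n) * (2 * pi / T) * s))) = 0"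
      using zero[of "-n"] \<open>T > 0\<close> by (simp add: fourier_coeff_def period_avg_def)
    also have "(\<lambda>s. of_real (g s) * cis (- (of_int (- n) * (2 * pi / T) * s))) = k"
      using c by (auto simp: k_def T field_simps)
    finally have "integral {0..T} k = 0" .
    moreover have "k integrable_on {0..T}"
      unfolding k_def
      using c by (intro integrable_continuous_real continuous_intros continuous_on_subset[OF cont]) auto
    ultimately have "(k has_integral 0) {0..T}" by (simp add: has_integral_iff)
    from has_integral_stretch_real[OF this, of c]
    have "((\<lambda>x. k (c * x)) has_integral 0) {0..2 * pi}"
      using c by (simp add: T image_divide_atLeastAtMost)
    then show "integral {0..2 * pi} (\<lambda>x. of_real (g (c * x)) * cis (of_int n * x)) = 0"
      using c by (simp add: k_def integral_unique)
  qed
  from this[of "s / c"] show ?thesis using c by simp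
qed

lemma fourier_coeff_add:
  assumes "periodic_input T \<zeta>" "periodic_input T \<xi>"
  shows "fourier_coeff T (\<lambda>s. \<zeta> s + \<xi> s) n = fourier_coeff T \<zeta> n + fourier_coeff T \<xi> n"
proof -
  let ?e = "\<lambda>s. cis (- (of_int n * (2 * pi / T) * s))"
  have int: "(\<lambda>s. complex_of_real (\<zeta> s) * ?e s) integrable_on {0..T}" if \<zeta>: "periodic_input T \<zeta>" for \<zeta>
  proof -
    obtain B where B: "\<And>s. \<bar>\<zeta> s\<bar> \<le> B" using \<zeta> by (meson periodic_input_bound)
    have "continuous_on UNIV ?e" by (intro continuous_intros)
    then have "?e \<in> borel_measurable lborel"
      using borel_measurable_continuous_onI by auto
    then have e: "?e \<in> borel_measurable lebesgue"
      by (rule measurable_completion)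
    have "\<zeta> \<in> borel_measurable lebesgue" using that by (simp add: periodic_input_def)
    then have "(\<lambda>s. complex_of_real (\<zeta> s)) \<in> borel_measurable lebesgue"
      using measurable_compose[OF _ borel_measurable_of_real, of \<zeta> lebesgue] by simp
    from borel_measurable_times[OF this e] B show ?thesis
      by (intro bounded_measurable_integrable_on[where B = B]) (simp_all add: norm_mult)
  qed
  show ?thesis
    unfolding fourier_coeff_def period_avg_def
    using integral_add[OF int[OF assms(1)] int[OF assms(2)]] by (simp add: algebra_simps)
qed

lemma fourier_coeff_cmult:
  "fourier_coeff T (\<lambda>s. c * \<zeta> s) n = of_real c * fourier_coeff T \<zeta> n"
  by (simp add: fourier_coeff_def period_avg_def mult.assoc algebra_simps)


section \<open>Lossless operators\<close>

lemma admissible_operator_response: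
  assumes "admissible_operator T L" "periodic_input T \<zeta>"
  shows "continuous_on UNIV (L \<zeta>)" and "periodic T (L \<zeta>)"
    and "period_avg T (\<lambda>s. \<zeta> s * L \<zeta> s) = 0"
  using assms unfolding admissible_operator_def by auto

text \<open>Linearity is not part of the definition of an admissible operator; it follows because
  the multiplier acts linearly on Fourier coefficients and these determine a continuous response at
  every point.\<close>

lemma admissible_operator_add:
  assumes T: "T > 0" and L: "admissible_operator T L" and \<zeta>: "periodic_input T \<zeta>" and \<xi>: "periodic_input T \<xi>"
  shows "L (\<lambda>s. \<zeta> s + \<xi> s) s = L \<zeta> s + L \<xi> s"
proof -
  obtain l where l: "\<And>\<zeta> n. periodic_input T \<zeta> \<Longrightarrow>
      fourier_coeff T (L \<zeta>) n = l (of_int n * (2 * pi / T)) * fourier_coeff T \<zeta> n"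
    using L unfolding admissible_operator_def by blast
  note sum = periodic_input_add[OF \<zeta> \<xi>]
  define g where "g s = L (\<lambda>s. \<zeta> s + \<xi> s) s + (-1) * (L \<zeta> s + L \<xi> s)" for s
  note resp = admissible_operator_response(1,2)[OF L]
  have input: "periodic_input T (L \<zeta>)" if "periodic_input T \<zeta>" for \<zeta>
    using periodic_input_continuous[OF T] resp[OF that] by blast
  have "g s = 0"
  proof (rule fourier_coeff_zero_imp_zero[OF T, where g = g])
    show "periodic T g"
      using resp(2)[OF sum] resp(2)[OF \<zeta>] resp(2)[OF \<xi>] by (simp add: periodic_def g_def)
    show "continuous_on UNIV g"
      unfolding g_def by (intro continuous_intros resp sum \<zeta> \<xi>)
    show "fourier_coeff T g n = 0" for n
    proof -
      have "fourier_coeff T g n = fourier_coeff T (L (\<lambda>s. \<zeta> s + \<xi> s)) n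
          - (fourier_coeff T (L \<zeta>) n + fourier_coeff T (L \<xi>) n)"
        unfolding g_def
        using fourier_coeff_add[OF input[OF sum] periodic_input_cmult[OF periodic_input_add[OF input[OF \<zeta>] input[OF \<xi>]], of "-1"], of n]
          fourier_coeff_cmult[of T "-1" "\<lambda>s. L \<zeta> s + L \<xi> s" n] fourier_coeff_add[OF input[OF \<zeta>] input[OF \<xi>], of n]
        by simp
      then show ?thesis
        by (simp add: l[OF sum] l[OF \<zeta>] l[OF \<xi>] fourier_coeff_add[OF \<zeta> \<xi>] distrib_left)
    qed
  qed
  then show ?thesis by (simp add: g_def)
qed

text \<open>Polarization: losslessness for \<open>\<zeta>\<close>, \<open>\<xi>\<close> and their
  sum leaves only the cross terms.\<close>

lemma admissible_operator_antisymmetric: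
  assumes T: "T > 0" and L: "admissible_operator T L" and \<zeta>: "periodic_input T \<zeta>" and \<xi>: "periodic_input T \<xi>"
  shows "period_avg T (\<lambda>s. \<zeta> s * L \<xi> s) = - period_avg T (\<lambda>s. \<xi> s * L \<zeta> s)"
proof -
  note resp = admissible_operator_response[OF L]
  have input: "periodic_input T (\<lambda>s. \<zeta> s * L \<xi> s)" if "periodic_input T \<zeta>" "periodic_input T \<xi>" for \<zeta> \<xi>
    using that resp(1,2) by (auto intro!: periodic_input_mult periodic_input_continuous[OF T, of "L \<xi>"])
  have "0 = period_avg T (\<lambda>s. (\<zeta> s + \<xi> s) * L (\<lambda>s. \<zeta> s + \<xi> s) s)"
    using resp(3)[OF periodic_input_add[OF \<zeta> \<xi>]] by simp
  also have "\<dots> = period_avg T (\<lambda>s. (\<zeta> s * L \<zeta> s + \<xi> s * L \<xi> s) + (\<zeta> s * L \<xi> s + \<xi> s * L \<zeta> s))"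
    by (subst admissible_operator_add[OF T L \<zeta> \<xi>]) (simp add: algebra_simps)
  also have "\<dots> = period_avg T (\<lambda>s. \<zeta> s * L \<xi> s) + period_avg T (\<lambda>s. \<xi> s * L \<zeta> s)"
    using \<zeta> \<xi> resp(3) by (simp add: period_avg_add input periodic_input_add)
  finally show ?thesis by simp
qed

section \<open>Zero-crossings\<close>

lemma zero_crossing_sign_change:
  assumes "zero_crossing g s"
  obtains d \<sigma> where "d > 0" "\<bar>\<sigma>\<bar> = 1"
    "\<And>x. s < x \<Longrightarrow> x < s + d \<Longrightarrow> sgn (g x) = \<sigma>"
    "\<And>x. s - d < x \<Longrightarrow> x < s \<Longrightarrow> sgn (g x) = - \<sigma>"
proof -
  \<comment> \<open>The factor \<open>\<sigma>\<close>, later the common sign of the one-sided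
    derivatives, treats rising and falling crossings together.\<close>
  have *: "\<exists>d>0. \<forall>h>0. h < d \<longrightarrow> \<sigma> * k (s + h) > 0 \<and> \<sigma> * k (s - h) < 0"
    if "k s = 0" "(k has_real_derivative a) (at_left s)" "(k has_real_derivative b) (at_right s)"
      "\<sigma> * a > 0" "\<sigma> * b > 0" for k :: "real \<Rightarrow> real" and a b \<sigma>
  proof -
    have "((\<lambda>x. \<sigma> * k x) has_real_derivative \<sigma> * a) (at_left s)"
         "((\<lambda>x. \<sigma> * k x) has_real_derivative \<sigma> * b) (at_right s)"
      using that(2,3) by (auto intro: DERIV_cmult)
    from has_real_derivative_pos_inc_left[OF this(1) that(4)] has_real_derivative_pos_inc_right[OF this(2) that(5)]
    obtain d d' where "d > 0" "d' > 0" "\<forall>h>0. h < d \<longrightarrow> \<sigma> * k (s - h) < 0" "\<forall>h>0. h < d' \<longrightarrow> \<sigma> * k (s + h) > 0"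
      by (auto simp: \<open>k s = 0\<close>)
    then show ?thesis by (intro exI[of _ "min d d'"]) auto
  qed
  obtain a b where ab: "g s = 0" "(g has_real_derivative a) (at_left s)" "(g has_real_derivative b) (at_right s)"
    "a \<noteq> 0" "b \<noteq> 0" "sgn a = sgn b"
    using assms unfolding zero_crossing_def by auto
  have "sgn a * a > 0" "sgn a * b > 0"
    using ab(4-6) by (auto simp: sgn_if split: if_splits)
  from *[OF ab(1-3) this] obtain d where d: "d > 0" "\<And>h. h > 0 \<Longrightarrow> h < d \<Longrightarrow> sgn a * g (s + h) > 0 \<and> sgn a * g (s - h) < 0"
    by auto
  show ?thesis
  proof (rule that[of d "sgn a"])
    show "sgn (g x) = sgn a" if "s < x" "x < s + d" for x
      using d(2)[of "x - s"] that ab(4) by (auto simp: sgn_if split: if_splits)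
    show "sgn (g x) = - sgn a" if "s - d < x" "x < s" for x
      using d(2)[of "s - x"] that ab(4) by (auto simp: sgn_if split: if_splits)
  qed (use d(1) ab(4) in \<open>auto simp: abs_sgn_eq\<close>)
qed


section \<open>The branch of solutions\<close>

text \<open>A positive derivative would push \<open>g\<close> above \<open>g x\<close> just to the
  right of \<open>x\<close>.\<close>

lemma antimono_imp_deriv_nonpos:
  fixes g :: "real \<Rightarrow> real"
  assumes "(g has_real_derivative D) (at x)" and "x < b"
    and "\<And>y. x < y \<Longrightarrow> y < b \<Longrightarrow> g y \<le> g x"
  shows "D \<le> 0"
proof (rule ccontr)
  assume "\<not> D \<le> 0"
  then obtain d where d: "d > 0" "\<And>h. h > 0 \<Longrightarrow> h < d \<Longrightarrow> g x < g (x + h)"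
    using DERIV_pos_inc_right[OF assms(1)] by auto
  define h where "h = min (d / 2) ((b - x) / 2)"
  have "h > 0" "h < d" "x + h < b"
    using d(1) \<open>x < b\<close> by (auto simp: h_def min_def field_simps)
  then show False using d(2)[of h] assms(3)[of "x + h"] by simp
qed

lemma mult_sgn_le_abs: "a * sgn b \<le> \<bar>a\<bar>" for a b :: real
  by (simp add: sgn_if abs_if)

locale zc_branch =
  fixes T \<mu>\<^sub>c :: real and \<phi> :: "real \<Rightarrow> real" and m :: nat and t0 :: "nat \<Rightarrow> real"
    and L :: "(real \<Rightarrow> real) \<Rightarrow> (real \<Rightarrow> real)"
    and f :: "real \<Rightarrow> real \<Rightarrow> real" and t :: "nat \<Rightarrow> real \<Rightarrow> real"
  assumes T: "T > 0" and zc: "zc_function T \<phi>" and lab: "zero_labelling T \<phi> m t0"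
    and L: "admissible_operator T L"
    and f_eq: "\<And>\<mu> s. \<mu> \<in> {0..<\<mu>\<^sub>c} \<Longrightarrow> f \<mu> s = \<phi> s - \<mu> * L (\<lambda>x. sgn (f \<mu> x)) s"
    and feat: "\<And>\<mu>. \<mu> \<in> {0..<\<mu>\<^sub>c} \<Longrightarrow> zc_features T \<phi> m t0 (f \<mu>) (\<lambda>k. t k \<mu>)"
    and t_cont: "\<And>k. k \<in> {1..m} \<Longrightarrow> continuous_on {0..<\<mu>\<^sub>c} (t k)"
    and t_diff: "\<And>k \<mu>. k \<in> {1..m} \<Longrightarrow> \<mu> \<in> {0<..<\<mu>\<^sub>c} \<Longrightarrow> t k differentiable (at \<mu>)"
    and t_0: "\<And>k. k \<in> {1..m} \<Longrightarrow> t k 0 = t0 k"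
begin

abbreviation \<zeta> :: "real \<Rightarrow> real \<Rightarrow> real" where
  "\<zeta> \<mu> \<equiv> \<lambda>s. sgn (f \<mu> s)"

definition \<eta> :: "real \<Rightarrow> real" where
  "\<eta> \<mu> = period_avg T (\<lambda>s. \<bar>f \<mu> s\<bar>)"

text \<open>The integrand is \<open>2 * \<bar>f \<mu> s\<bar>\<close> where the two functions have
  opposite signs and \<open>0\<close> where their signs agree, so this measures their sign
  mismatch.\<close>

definition deficit :: "real \<Rightarrow> real \<Rightarrow> real" where
  "deficit \<mu> \<nu> = period_avg T (\<lambda>s. \<bar>f \<mu> s\<bar> - f \<mu> s * \<zeta> \<nu> s)"

lemma \<phi>_continuous: "continuous_on UNIV \<phi>" and \<phi>_periodic: "periodic T \<phi>"
  using zc by (auto simp: zc_function_def)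

lemma f_continuous: "\<mu> \<in> {0..<\<mu>\<^sub>c} \<Longrightarrow> continuous_on UNIV (f \<mu>)"
  and f_periodic: "\<mu> \<in> {0..<\<mu>\<^sub>c} \<Longrightarrow> periodic T (f \<mu>)"
  and f_nonzero: "\<mu> \<in> {0..<\<mu>\<^sub>c} \<Longrightarrow> \<exists>s. f \<mu> s \<noteq> 0"
  and f_zero_crossing: "\<mu> \<in> {0..<\<mu>\<^sub>c} \<Longrightarrow> f \<mu> s = 0 \<Longrightarrow> zero_crossing (f \<mu>) s"
  and t_labelling: "\<mu> \<in> {0..<\<mu>\<^sub>c} \<Longrightarrow> zero_labelling T (f \<mu>) m (\<lambda>k. t k \<mu>)"
  using feat[of \<mu>] by (auto simp: zc_features_def zc_function_def)

lemma input_f: "\<mu> \<in> {0..<\<mu>\<^sub>c} \<Longrightarrow> periodic_input T (f \<mu>)"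
  and input_\<zeta>: "\<mu> \<in> {0..<\<mu>\<^sub>c} \<Longrightarrow> periodic_input T (\<zeta> \<mu>)"
  and input_\<phi>: "periodic_input T \<phi>"
  using periodic_input_continuous[OF T] periodic_input_sgn f_continuous f_periodic \<phi>_continuous \<phi>_periodic
  by auto

lemma input_abs_f:
  assumes "\<mu> \<in> {0..<\<mu>\<^sub>c}" shows "periodic_input T (\<lambda>s. \<bar>f \<mu> s\<bar>)"
  using periodic_input_mult[OF input_f input_\<zeta>, OF assms assms] by (simp add: abs_sgn)

lemma \<eta>_pos:
  assumes "\<mu> \<in> {0..<\<mu>\<^sub>c}" shows "\<eta> \<mu> > 0"
proof -
  obtain s' where s': "f \<mu> s' \<noteq> 0" using f_nonzero[OF assms] by auto
  obtain s where s: "s \<in> {0..<T}" "f \<mu> s' = f \<mu> s"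
    using periodic_reduce[OF f_periodic[OF assms] T] .
  have cont: "continuous_on {0..T} (\<lambda>s. \<bar>f \<mu> s\<bar>)"
    using f_continuous[OF assms] by (intro continuous_intros) (auto intro: continuous_on_subset)
  have "integral {0..T} (\<lambda>s. \<bar>f \<mu> s\<bar>) \<noteq> 0"
    using integral_eq_0_iff[OF cont T] s s' by fastforce
  moreover have "integral {0..T} (\<lambda>s. \<bar>f \<mu> s\<bar>) \<ge> 0"
    by (intro integral_nonneg integrable_continuous_real cont) auto
  ultimately show ?thesis using T by (simp add: \<eta>_def period_avg_def)
qed

lemma input_deficit:
  assumes "\<mu> \<in> {0..<\<mu>\<^sub>c}" "\<nu> \<in> {0..<\<mu>\<^sub>c}"
  shows "periodic_input T (\<lambda>s. \<bar>f \<mu> s\<bar> - f \<mu> s * \<zeta> \<nu> s)"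
  using assms by (intro periodic_input_diff periodic_input_mult input_abs_f input_f input_\<zeta>)

lemma deficit_nonneg:
  assumes "\<mu> \<in> {0..<\<mu>\<^sub>c}" "\<nu> \<in> {0..<\<mu>\<^sub>c}" shows "deficit \<mu> \<nu> \<ge> 0"
  unfolding deficit_def period_avg_def
  using T periodic_input_integrable[OF input_deficit[OF assms]]
  by (intro scaleR_nonneg_nonneg integral_nonneg) (auto intro: mult_sgn_le_abs)

section \<open>Averaged identities and the decrease of \<open>\<eta>\<close>\<close>

text \<open>The equation at \<open>\<mu>\<close> is tested with the sign function at a second
  parameter \<open>\<nu>\<close>. The left side depends on \<open>\<nu>\<close> alone, so different
  choices of \<open>\<mu>\<close> give comparable expressions for it.\<close>

lemma avg_\<phi>_\<zeta>:
  assumes "\<mu> \<in> {0..<\<mu>\<^sub>c}" "\<nu> \<in> {0..<\<mu>\<^sub>c}"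
  shows "period_avg T (\<lambda>s. \<phi> s * \<zeta> \<nu> s) =
    period_avg T (\<lambda>s. f \<mu> s * \<zeta> \<nu> s) + \<mu> * period_avg T (\<lambda>s. \<zeta> \<nu> s * L (\<zeta> \<mu>) s)"
proof -
  have in1: "periodic_input T (\<lambda>s. f \<mu> s * \<zeta> \<nu> s)"
    by (intro periodic_input_mult input_f input_\<zeta> assms)
  have "periodic_input T (L (\<zeta> \<mu>))"
    using admissible_operator_response(1,2)[OF L input_\<zeta>] assms by (intro periodic_input_continuous[OF T]) auto
  then have in2: "periodic_input T (\<lambda>s. \<zeta> \<nu> s * L (\<zeta> \<mu>) s)"
    by (intro periodic_input_mult[OF input_\<zeta>] assms)
  have "\<phi> s * \<zeta> \<nu> s = f \<mu> s * \<zeta> \<nu> s + \<mu> * (\<zeta> \<nu> s * L (\<zeta> \<mu>) s)" for s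
  proof -
    have "\<phi> s = f \<mu> s + \<mu> * L (\<zeta> \<mu>) s"
      using f_eq[OF assms(1), of s] by simp
    then show ?thesis by (simp only: algebra_simps)
  qed
  then show ?thesis
    by (simp add: period_avg_add[OF in1 periodic_input_cmult[OF in2]] period_avg_cmult)
qed

text \<open>For equal parameters the operator term is
  \<open>\<langle>\<zeta> L \<zeta>\<rangle>\<close>, which losslessness removes.\<close>

lemma \<eta>_eq_avg_\<phi>_\<zeta>:
  assumes "\<mu> \<in> {0..<\<mu>\<^sub>c}" shows "\<eta> \<mu> = period_avg T (\<lambda>s. \<phi> s * \<zeta> \<mu> s)"
  using avg_\<phi>_\<zeta>[OF assms assms] admissible_operator_response(3)[OF L input_\<zeta>[OF assms]]
  by (simp add: \<eta>_def abs_sgn)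

text \<open>With \<open>\<beta> = \<langle>\<zeta> \<nu> L (\<zeta> \<mu>)\<rangle>\<close> one has \<open>\<eta> \<nu> - \<eta> \<mu> = \<mu> \<beta> - deficit \<mu> \<nu> = \<nu> \<beta> + deficit \<nu> \<mu>\<close>,
  so \<open>\<mu> < \<nu>\<close> forces \<open>\<beta> \<le> 0\<close>.\<close>
lemma \<eta>_drop:
  assumes "0 \<le> \<mu>" "\<mu> < \<nu>" "\<nu> < \<mu>\<^sub>c"
  shows "\<eta> \<nu> \<le> \<eta> \<mu> - deficit \<mu> \<nu>"
proof -
  have \<mu>: "\<mu> \<in> {0..<\<mu>\<^sub>c}" and \<nu>: "\<nu> \<in> {0..<\<mu>\<^sub>c}" using assms by auto
  define \<beta> where "\<beta> = period_avg T (\<lambda>s. \<zeta> \<nu> s * L (\<zeta> \<mu>) s)"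
  have \<beta>': "period_avg T (\<lambda>s. \<zeta> \<mu> s * L (\<zeta> \<nu>) s) = - \<beta>"
    unfolding \<beta>_def by (rule admissible_operator_antisymmetric[OF T L input_\<zeta>[OF \<mu>] input_\<zeta>[OF \<nu>]])
  have def_eq: "deficit \<mu> \<nu> = \<eta> \<mu> - period_avg T (\<lambda>s. f \<mu> s * \<zeta> \<nu> s)"
    if "\<mu> \<in> {0..<\<mu>\<^sub>c}" "\<nu> \<in> {0..<\<mu>\<^sub>c}" for \<mu> \<nu>
    unfolding deficit_def \<eta>_def using that
    by (intro period_avg_diff periodic_input_mult input_abs_f input_f input_\<zeta>)
  have 1: "\<eta> \<nu> = \<eta> \<mu> - deficit \<mu> \<nu> + \<mu> * \<beta>"
    using avg_\<phi>_\<zeta>[OF \<mu> \<nu>] def_eq[OF \<mu> \<nu>] by (simp add: \<eta>_eq_avg_\<phi>_\<zeta>[OF \<nu>] \<beta>_def)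
  have 2: "\<eta> \<mu> = \<eta> \<nu> - deficit \<nu> \<mu> - \<nu> * \<beta>"
    using avg_\<phi>_\<zeta>[OF \<nu> \<mu>] def_eq[OF \<nu> \<mu>] by (simp add: \<eta>_eq_avg_\<phi>_\<zeta>[OF \<mu>] \<beta>')
  have "(\<nu> - \<mu>) * \<beta> = - (deficit \<mu> \<nu> + deficit \<nu> \<mu>)"
    using 1 2 by (simp add: algebra_simps)
  also have "\<dots> \<le> 0" using deficit_nonneg[OF \<mu> \<nu>] deficit_nonneg[OF \<nu> \<mu>] by simp
  finally have "\<beta> \<le> 0" using assms(2) by (simp add: mult_le_0_iff)
  then show ?thesis using 1 assms(1) by (simp add: mult_nonneg_nonpos)
qed

section \<open>Rigidity of the zeros\<close>

text \<open>If \<open>f \<mu> s\<close> were nonzero, \<open>f \<mu>\<close> would keep its sign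
  near \<open>s\<close> while \<open>f \<nu>\<close> changes sign there. On one side of
  \<open>s\<close> the signs would then be opposite on a whole interval, making the deficit
  positive.\<close>

lemma zeros_antimono:
  assumes "\<mu> \<in> {0..<\<mu>\<^sub>c}" "\<nu> \<in> {0..<\<mu>\<^sub>c}" "deficit \<mu> \<nu> = 0" "f \<nu> s = 0"
  shows "f \<mu> s = 0"
proof (rule ccontr)
  assume nz: "f \<mu> s \<noteq> 0"
  let ?h = "\<lambda>x. \<bar>f \<mu> x\<bar> - f \<mu> x * \<zeta> \<nu> x"
  note int = periodic_input_integrable[OF input_deficit[OF assms(1,2)]]
  \<comment> \<open>The integrand is nonnegative, so a vanishing integral over a period vanishes on
    every part of that period.\<close>
  have zero: "integral {u..v} ?h = 0" if "u \<le> v" "v \<le> u + T" for u v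
  proof -
    have "integral {u..u + T} ?h = integral {0..T} ?h"
      using input_deficit[OF assms(1,2)] int by (intro integral_periodic_shift T) (auto simp: periodic_input_def)
    also have "\<dots> = 0" using assms(3) T by (simp add: deficit_def period_avg_def)
    finally have "integral {u..v} ?h \<le> 0"
      using integral_subset_le[of "{u..v}" "{u..u + T}" ?h] int that mult_sgn_le_abs by auto
    moreover have "integral {u..v} ?h \<ge> 0"
      using int by (intro integral_nonneg) (auto intro: mult_sgn_le_abs)
    ultimately show ?thesis by simp
  qed
  obtain d \<sigma> where d: "d > 0" "\<bar>\<sigma>\<bar> = 1"
    "\<And>x. s < x \<Longrightarrow> x < s + d \<Longrightarrow> sgn (f \<nu> x) = \<sigma>"
    "\<And>x. s - d < x \<Longrightarrow> x < s \<Longrightarrow> sgn (f \<nu> x) = - \<sigma>"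
    using zero_crossing_sign_change[OF f_zero_crossing[OF assms(2,4)]] by metis
  have cont: "continuous_on UNIV (f \<mu>)" using f_continuous assms by auto
  then have "isCont (f \<mu>) s" by (simp add: continuous_on_eq_continuous_at)
  from continuous_at_avoid[OF this nz] obtain e where e: "e > 0" "\<And>y. dist s y < e \<Longrightarrow> f \<mu> y \<noteq> 0"
    by auto
  \<comment> \<open>On an interval of opposite signs \<open>?h\<close> equals
    \<open>2 * \<bar>f \<mu> x\<bar>\<close>, a continuous function that is nonzero at
    \<open>u\<close>.\<close>
  have *: False if uv: "u < v" "v \<le> u + T" and \<tau>: "\<And>x. x \<in> {u..v} \<Longrightarrow> \<zeta> \<nu> x = - sgn (f \<mu> x)"
    and nz: "f \<mu> u \<noteq> 0" for u v
  proof -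
    have "integral {u..v} (\<lambda>x. 2 * \<bar>f \<mu> x\<bar>) = integral {u..v} ?h"
      using \<tau> by (intro integral_cong) (simp add: abs_sgn)
    also have "\<dots> = 0" using zero uv by simp
    finally have "\<forall>x\<in>{u..v}. 2 * \<bar>f \<mu> x\<bar> = 0"
      using uv by (subst (asm) integral_eq_0_iff) (auto intro!: continuous_intros continuous_on_subset[OF cont])
    then show False using uv nz by auto
  qed
  have same: "sgn (f \<mu> x) = sgn (f \<mu> s)" if "\<bar>x - s\<bar> < e" for x
  proof (rule ccontr)
    assume ne: "sgn (f \<mu> x) \<noteq> sgn (f \<mu> s)"
    have nzx: "f \<mu> x \<noteq> 0"
      using e(2)[of x] that by (simp add: dist_real_def abs_minus_commute)
    have "\<exists>y. min x s \<le> y \<and> y \<le> max x s \<and> f \<mu> y = 0"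
    proof -
      have c: "continuous_on {min x s..max x s} (f \<mu>)" using cont by (rule continuous_on_subset) simp
      show ?thesis
      proof (cases "f \<mu> (min x s) \<le> 0")
        case True
        then show ?thesis using ne nz nzx c
          by (intro IVT') (auto simp: min_def max_def sgn_if split: if_splits)
      next
        case False
        then show ?thesis using ne nz nzx c
          by (intro IVT2') (auto simp: min_def max_def sgn_if split: if_splits)
      qed
    qed
    then show False using e(2) that by (fastforce simp: dist_real_def min_def max_def split: if_splits)
  qed
  \<comment> \<open>Below \<open>T\<close> the interval fits into one period, below \<open>d\<close>
    the sign of \<open>f \<nu>\<close> is known, and below \<open>e\<close> that of
    \<open>f \<mu>\<close>.\<close>
  define r where "r = min (T / 2) (min (d / 2) (e / 2))"
  have r: "r > 0" "r < T" "r < d" "r < e"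
    using T d(1) e(1) by (auto simp: r_def min_def)
  have "sgn (f \<mu> s) = \<sigma> \<or> sgn (f \<mu> s) = - \<sigma>"
    using nz d(2) by (auto simp: sgn_if abs_if split: if_splits)
  then show False
  proof
    assume \<sigma>: "sgn (f \<mu> s) = - \<sigma>"
    \<comment> \<open>The mismatch lies to the right of \<open>s\<close>. The interval starts at
      \<open>s + r / 2\<close> because \<open>f \<nu>\<close> has sign \<open>\<sigma>\<close> only
      strictly to the right of \<open>s\<close>. The other case is its mirror image.\<close>
    show False
    proof (rule *[of "s + r / 2" "s + r"])
      show "\<zeta> \<nu> x = - sgn (f \<mu> x)" if "x \<in> {s + r / 2..s + r}" for x
        using that r d(3)[of x] same[of x] \<sigma> by auto
      show "f \<mu> (s + r / 2) \<noteq> 0" using e(2)[of "s + r / 2"] r by (simp add: dist_real_def)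
    qed (use r in auto)
  next
    assume \<sigma>: "sgn (f \<mu> s) = \<sigma>"
    show False
    proof (rule *[of "s - r" "s - r / 2"])
      show "\<zeta> \<nu> x = - sgn (f \<mu> x)" if "x \<in> {s - r..s - r / 2}" for x
        using that r d(4)[of x] same[of x] \<sigma> by auto
      show "f \<mu> (s - r) \<noteq> 0" using e(2)[of "s - r"] r by (simp add: dist_real_def)
    qed (use r in auto)
  qed
qed

lemma t_zero:
  assumes "k \<in> {1..m}" "\<mu> \<in> {0..<\<mu>\<^sub>c}" shows "f \<mu> (t k \<mu>) = 0"
  using t_labelling[OF assms(2)] assms(1) unfolding zero_labelling_def by blast

text \<open>For fixed positive \<open>\<mu>\<close>, constancy of \<open>\<eta>\<close> makes every
  deficit \<open>deficit \<mu> x\<close> with \<open>x > \<mu>\<close> vanish, so all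
  \<open>t k x\<close> are zeros of the single function \<open>f \<mu>\<close>. Its zeros are
  isolated, and a continuous path through isolated points is constant.\<close>

lemma t_constant_if_\<eta>_constant:
  assumes const: "\<And>\<mu> \<nu>. \<mu> \<in> {0<..<\<mu>\<^sub>c} \<Longrightarrow> \<nu> \<in> {0<..<\<mu>\<^sub>c} \<Longrightarrow> \<eta> \<mu> = \<eta> \<nu>"
    and k: "k \<in> {1..m}" and \<nu>: "\<nu> \<in> {0..<\<mu>\<^sub>c}"
  shows "t k \<nu> = t0 k"
proof (cases "\<nu> = 0")
  case True then show ?thesis using t_0[OF k] by simp
next
  case False
  with \<nu> have \<nu>: "\<nu> \<in> {0<..<\<mu>\<^sub>c}" by auto
  have eq: "t k \<mu> = t k \<nu>" if \<mu>: "\<mu> \<in> {0<..\<nu>}" for \<mu>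
  proof -
    have zero: "f \<mu> (t k x) = 0" if "x \<in> {\<mu>..\<nu>}" for x
    proof (cases "x = \<mu>")
      case True then show ?thesis using t_zero[OF k] \<mu> \<nu> by auto
    next
      case False
      then have "deficit \<mu> x \<le> 0"
        using \<eta>_drop[of \<mu> x] const[of \<mu> x] that \<mu> \<nu> by auto
      then have "deficit \<mu> x = 0" using deficit_nonneg[of \<mu> x] that \<mu> \<nu> by auto
      then show ?thesis using zeros_antimono[of \<mu> x] t_zero[OF k, of x] that \<mu> \<nu> by auto
    qed
    have "t k constant_on {\<mu>..\<nu>}"
    proof (rule continuous_discrete_range_constant)
      show "connected {\<mu>..\<nu>}" by simp
      show "continuous_on {\<mu>..\<nu>} (t k)"
        using \<mu> \<nu> by (intro continuous_on_subset[OF t_cont[OF k]]) auto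
      fix x assume "x \<in> {\<mu>..\<nu>}"
      with \<mu> \<nu> zero have "zero_crossing (f \<mu>) (t k x)" by (intro f_zero_crossing) auto
      then have "\<forall>\<^sub>F y in at (t k x). f \<mu> y \<noteq> 0" by (simp add: zero_crossing_def)
      then obtain e where "e > 0" "\<And>y. y \<noteq> t k x \<Longrightarrow> dist y (t k x) < e \<Longrightarrow> f \<mu> y \<noteq> 0"
        by (auto simp: eventually_at)
      then show "\<exists>e>0. \<forall>y. y \<in> {\<mu>..\<nu>} \<and> t k y \<noteq> t k x \<longrightarrow> e \<le> norm (t k y - t k x)"
        using zero by (intro exI[of _ e]) (auto simp: dist_norm not_less[symmetric])
    qed
    then show ?thesis using \<mu> unfolding constant_on_def by auto
  qed
  \<comment> \<open>Constancy of \<open>\<eta>\<close> is assumed for positive parameters only, so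
    the parameter 0 is reached by right continuity of \<open>t k\<close>.\<close>
  have "(t k \<longlongrightarrow> t k 0) (at_right 0)"
    using \<nu> by (intro continuous_on_Icc_at_rightD[of 0 \<nu>] continuous_on_subset[OF t_cont[OF k]]) auto
  moreover have "\<forall>\<^sub>F x in at_right 0. t k x = t k \<nu>"
    using eventually_at_right_less[of 0] eventually_at_right_real[of 0 \<nu>] \<nu>
    by (auto elim!: eventually_mono intro!: eq)
  then have "(t k \<longlongrightarrow> t k \<nu>) (at_right 0)"
    by (simp add: tendsto_eventually)
  ultimately have "t k 0 = t k \<nu>"
    by (intro tendsto_unique[OF trivial_limit_at_right_real])
  then show ?thesis using t_0[OF k] by simp
qed

section \<open>\<open>\<eta>\<close> as a function of the zeros\<close>

text \<open>By \<open>zc_features\<close> this is also the sign of every \<open>f \<mu>\<close> on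
  its own \<open>k\<close>-th interval, hence independent of \<open>\<mu>\<close>. The midpoint is
  merely a convenient interior point.\<close>

definition \<sigma> :: "nat \<Rightarrow> real" where
  "\<sigma> k = sgn (\<phi> ((t0 k + t0 (k + 1)) / 2))"

lemma m_pos: "m \<ge> 1"
proof (rule ccontr)
  assume "\<not> m \<ge> 1"
  then have "m = 0" by simp
  \<comment> \<open>With \<open>m = 0\<close> the labelling would say
    \<open>t0 1 = t0 1 + T\<close>.\<close>
  then show False using lab T by (simp add: zero_labelling_def)
qed

text \<open>Between consecutive zeros the sign factor in
  \<open>\<langle>\<phi> sign f\<rangle>\<close> is constant, so each piece is an increment of
  \<open>\<Phi>\<close>. All dependence on \<open>\<mu>\<close> now sits in the zeros.\<close>

lemma \<eta>_formula:
  assumes \<Phi>: "\<And>x. (\<Phi> has_real_derivative \<phi> x) (at x)" and \<mu>: "\<mu> \<in> {0..<\<mu>\<^sub>c}"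
  shows "\<eta> \<mu> = (\<Sum>k=1..m. \<sigma> k * (\<Phi> (t (k + 1) \<mu>) - \<Phi> (t k \<mu>))) / T"
proof -
  let ?g = "\<lambda>s. \<phi> s * \<zeta> \<mu> s"
  have g: "periodic_input T ?g" by (intro periodic_input_mult input_\<phi> input_\<zeta> \<mu>)
  note int = periodic_input_integrable[OF g]
  have mono: "strict_mono_on {1..m + 1} (\<lambda>k. t k \<mu>)" and end_t: "t (m + 1) \<mu> = t 1 \<mu> + T"
    using t_labelling[OF \<mu>] by (auto simp: zero_labelling_def)
  have piece: "integral {t k \<mu>..t (k + 1) \<mu>} ?g = \<sigma> k * (\<Phi> (t (k + 1) \<mu>) - \<Phi> (t k \<mu>))"
    if k: "k \<in> {1..m}" for k
  proof -
    have le: "t k \<mu> \<le> t (k + 1) \<mu>"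
      using k strict_mono_onD[OF mono, of k "k + 1"] by simp
    have "t0 k < t0 (k + 1)"
      using k lab strict_mono_onD[of "{1..m + 1}" t0 k "k + 1"] by (simp add: zero_labelling_def)
    then have sgn: "\<zeta> \<mu> s = \<sigma> k" if "s \<in> {t k \<mu><..<t (k + 1) \<mu>}" for s
      using feat[OF \<mu>] k that unfolding zc_features_def \<sigma>_def by force
    have "(\<phi> has_integral \<Phi> (t (k + 1) \<mu>) - \<Phi> (t k \<mu>)) {t k \<mu>..t (k + 1) \<mu>}"
      using le \<Phi> by (intro fundamental_theorem_of_calculus)
        (auto simp: has_real_derivative_iff_has_vector_derivative[symmetric] intro: has_field_derivative_at_within)
    then have "((\<lambda>s. \<sigma> k * \<phi> s) has_integral \<sigma> k * (\<Phi> (t (k + 1) \<mu>) - \<Phi> (t k \<mu>))) {t k \<mu>..t (k + 1) \<mu>}"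
      by (rule has_integral_mult_right)
    \<comment> \<open>The two integrands can differ only at the endpoints, where
      \<open>f \<mu>\<close> vanishes.\<close>
    then have "(?g has_integral \<sigma> k * (\<Phi> (t (k + 1) \<mu>) - \<Phi> (t k \<mu>))) {t k \<mu>..t (k + 1) \<mu>}"
      by (rule has_integral_spike_finite[rotated 2, where S = "{t k \<mu>, t (k + 1) \<mu>}"]) (auto simp: sgn)
    then show ?thesis by (rule integral_unique)
  qed
  have "n \<le> m \<Longrightarrow> integral {t 1 \<mu>..t (n + 1) \<mu>} ?g = (\<Sum>k=1..n. integral {t k \<mu>..t (k + 1) \<mu>} ?g)" for n
  proof (induction n)
    case (Suc n)
    have "t 1 \<mu> \<le> t (n + 1) \<mu>" "t (n + 1) \<mu> \<le> t (n + 2) \<mu>"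
      using Suc.prems strict_mono_on_leD[OF mono] by auto
    then have "integral {t 1 \<mu>..t (n + 1) \<mu>} ?g + integral {t (n + 1) \<mu>..t (n + 2) \<mu>} ?g = integral {t 1 \<mu>..t (n + 2) \<mu>} ?g"
      using int by (rule Henstock_Kurzweil_Integration.integral_combine)
    then show ?case using Suc by simp
  qed simp
  from this[of m] have "integral {t 1 \<mu>..t 1 \<mu> + T} ?g = (\<Sum>k=1..m. \<sigma> k * (\<Phi> (t (k + 1) \<mu>) - \<Phi> (t k \<mu>)))"
    using piece end_t by simp
  moreover have "integral {t 1 \<mu>..t 1 \<mu> + T} ?g = integral {0..T} ?g"
    using g int by (intro integral_periodic_shift T) (auto simp: periodic_input_def)
  ultimately show ?thesis
    by (simp add: \<eta>_eq_avg_\<phi>_\<zeta>[OF \<mu>] period_avg_def)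
qed

lemma antiderivative_\<phi>: "\<exists>\<Phi>. \<forall>x. (\<Phi> has_real_derivative \<phi> x) (at x)"
proof -
  have "isCont \<phi> x" for x
    using \<phi>_continuous by (simp add: continuous_on_eq_continuous_at)
  then show ?thesis
    using einterval_antiderivative[of "-\<infinity>" \<infinity> \<phi>]
    by (simp add: has_real_derivative_iff_has_vector_derivative)
qed

lemma \<eta>_differentiable:
  assumes "\<mu> \<in> {0<..<\<mu>\<^sub>c}" shows "\<eta> differentiable (at \<mu>)"
proof -
  obtain \<Phi> where \<Phi>: "\<And>x. (\<Phi> has_real_derivative \<phi> x) (at x)"
    using antiderivative_\<phi> by auto
  \<comment> \<open>Differentiability is given for \<open>k \<le> m\<close> only, and
    \<open>t (m + 1)\<close> agrees with \<open>t 1 + T\<close> only for parameters in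
    \<open>{0..<\<mu>\<^sub>c}\<close>; \<open>u\<close> makes this an identity of
    functions.\<close>
  define u where "u k x = (if k = m + 1 then t 1 x + T else t k x)" for k x
  have t_u: "t k x = u k x" if "x \<in> {0<..<\<mu>\<^sub>c}" for k x
    using t_labelling[of x] that by (auto simp: u_def zero_labelling_def)
  have "u k differentiable (at \<mu>)" if "k \<in> {1..m + 1}" for k
    using that t_diff[OF _ assms] m_pos by (cases "k = m + 1") (auto simp: u_def[abs_def])
  then have \<Phi>u: "(\<lambda>x. \<Phi> (u k x)) differentiable (at \<mu>)" if "k \<in> {1..m + 1}" for k
    using that \<Phi> DERIV_chain2 unfolding real_differentiable_def by metis
  have "(\<lambda>x. (\<Sum>k=1..m. \<sigma> k * (\<Phi> (u (k + 1) x) - \<Phi> (u k x))) / T) differentiable (at \<mu>)"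
    using T by (intro differentiable_divide differentiable_sum differentiable_mult differentiable_diff \<Phi>u ballI) auto
  moreover have "\<forall>\<^sub>F x in nhds \<mu>. x \<in> {0<..<\<mu>\<^sub>c}"
    using assms by (intro eventually_nhds_in_open) auto
  then have "\<forall>\<^sub>F x in nhds \<mu>. \<eta> x = (\<Sum>k=1..m. \<sigma> k * (\<Phi> (u (k + 1) x) - \<Phi> (u k x))) / T"
    by eventually_elim (simp add: \<eta>_formula[OF \<Phi>] t_u)
  ultimately show ?thesis
    by (simp add: real_differentiable_def DERIV_cong_ev[OF refl _ refl])
qed

lemma \<eta>_constant_if_t_constant:
  assumes "\<And>k \<mu>. k \<in> {1..m} \<Longrightarrow> \<mu> \<in> {0..<\<mu>\<^sub>c} \<Longrightarrow> t k \<mu> = t0 k"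
    and \<mu>: "\<mu> \<in> {0..<\<mu>\<^sub>c}" and \<nu>: "\<nu> \<in> {0..<\<mu>\<^sub>c}"
  shows "\<eta> \<mu> = \<eta> \<nu>"
proof -
  obtain \<Phi> where \<Phi>: "\<And>x. (\<Phi> has_real_derivative \<phi> x) (at x)"
    using antiderivative_\<phi> by auto
  have "t k \<mu> = t k \<nu>" if "k \<in> {1..m + 1}" for k
    using that assms(1)[of k] assms(1)[of 1] \<mu> \<nu> t_labelling[OF \<mu>] t_labelling[OF \<nu>] m_pos
    by (cases "k = m + 1") (auto simp: zero_labelling_def)
  then show ?thesis
    unfolding \<eta>_formula[OF \<Phi> \<mu>] \<eta>_formula[OF \<Phi> \<nu>] by (auto intro!: arg_cong[of _ _ "\<lambda>x. x / T"] sum.cong)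
qed

lemma \<eta>_deriv_nonpos:
  assumes "\<mu> \<in> {0<..<\<mu>\<^sub>c}" shows "deriv \<eta> \<mu> \<le> 0"
proof (rule antimono_imp_deriv_nonpos)
  show "(\<eta> has_real_derivative deriv \<eta> \<mu>) (at \<mu>)"
    using \<eta>_differentiable[OF assms] by (simp add: DERIV_deriv_iff_real_differentiable)
  show "\<eta> \<nu> \<le> \<eta> \<mu>" if "\<mu> < \<nu>" "\<nu> < \<mu>\<^sub>c" for \<nu>
    using \<eta>_drop[of \<mu> \<nu>] deficit_nonneg[of \<mu> \<nu>] that assms by auto
qed (use assms in auto)

section \<open>The power and its logarithmic derivative\<close>

lemma mean_power_eq:
  assumes "A > 0" "U > 0"
  shows "mean_power T A f U = A * U * \<eta> (A / U)"
proof -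
  have "current A f U s * voltage A f U s = (A * U) * \<bar>f (A / U) s\<bar>" for s
    using assms by (simp add: current_def voltage_def sgn_mult abs_sgn)
  then show ?thesis by (simp add: mean_power_def \<eta>_def period_avg_cmult)
qed

text \<open>With \<open>x = ln U\<close> one has \<open>\<mu> = A * exp (- x)\<close> and
  \<open>ln P = ln A + x + ln (\<eta> \<mu>)\<close>; the chain rule uses that \<open>\<mu>\<close>
  has derivative \<open>- \<mu>\<close> in \<open>x\<close>.\<close>

lemma DERIV_log_power:
  assumes A: "A > 0" and \<mu>: "\<mu> \<in> {0<..<\<mu>\<^sub>c}"
  shows "(log_power T A f has_real_derivative 1 - \<mu> * deriv \<eta> \<mu> / \<eta> \<mu>) (at (ln (A / \<mu>)))"
proof -
  let ?x = "ln (A / \<mu>)"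
  have "exp (- ?x) = inverse (A / \<mu>)"
    using A \<mu> by (subst exp_minus, subst exp_ln) auto
  then have \<mu>_eq: "A * exp (- ?x) = \<mu>" using A by simp
  have pos: "\<eta> \<mu> > 0" using \<eta>_pos \<mu> by auto
  have D\<eta>: "(\<eta> has_real_derivative deriv \<eta> \<mu>) (at (A * exp (- ?x)))"
    using \<eta>_differentiable[OF \<mu>] unfolding \<mu>_eq by (simp add: DERIV_deriv_iff_real_differentiable)
  have "((\<lambda>x. A * exp (- x)) has_real_derivative - \<mu>) (at ?x)"
    by (rule derivative_eq_intros refl)+ (use \<mu>_eq in \<open>simp add: mult.commute\<close>)
  note D\<eta>' = DERIV_chain2[OF D\<eta> this]
  have "(ln has_real_derivative 1 / \<eta> \<mu>) (at (\<eta> (A * exp (- ?x))))"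
    unfolding \<mu>_eq using pos by (rule DERIV_ln_divide)
  from DERIV_chain2[OF this D\<eta>']
  have "((\<lambda>x. ln (\<eta> (A * exp (- x)))) has_real_derivative 1 / \<eta> \<mu> * (deriv \<eta> \<mu> * - \<mu>)) (at ?x)" .
  then have "((\<lambda>x. ln A + x + ln (\<eta> (A * exp (- x)))) has_real_derivative 0 + 1 + 1 / \<eta> \<mu> * (deriv \<eta> \<mu> * - \<mu>)) (at ?x)"
    by (intro derivative_intros)
  then have D: "((\<lambda>x. ln A + x + ln (\<eta> (A * exp (- x)))) has_real_derivative 1 - \<mu> * deriv \<eta> \<mu> / \<eta> \<mu>) (at ?x)"
    by (simp add: mult.commute)
  \<comment> \<open>Splitting the logarithm requires \<open>\<eta>\<close> to be positive, which is
    known for parameters below \<open>\<mu>\<^sub>c\<close>; by continuity this holds in a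
    neighbourhood of \<open>?x\<close>.\<close>
  have "((\<lambda>x. A * exp (- x)) \<longlongrightarrow> \<mu>) (nhds ?x)"
    using \<mu>_eq by (auto intro!: tendsto_eq_intros filterlim_ident)
  then have "\<forall>\<^sub>F x in nhds ?x. A * exp (- x) < \<mu>\<^sub>c"
    using \<mu> by (intro order_tendstoD) auto
  then have "\<forall>\<^sub>F x in nhds ?x. log_power T A f x = ln A + x + ln (\<eta> (A * exp (- x)))"
  proof eventually_elim
    case (elim x)
    then have "\<eta> (A * exp (- x)) > 0" using A by (intro \<eta>_pos) auto
    then show ?case
      using A by (simp add: log_power_def mean_power_eq ln_mult exp_minus divide_inverse)
  qed
  from DERIV_cong_ev[OF refl this refl] D show ?thesis by simp
qed

lemma K_U_eq:
  assumes "A > 0" and "\<mu> \<in> {0<..<\<mu>\<^sub>c}"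
  shows "K_U T A f \<mu> = 1 - \<mu> * deriv \<eta> \<mu> / \<eta> \<mu>"
  unfolding K_U_def using DERIV_log_power[OF assms] by (rule DERIV_imp_deriv)

lemma K_U_eq_1_iff:
  assumes "A > 0" and "\<mu> \<in> {0<..<\<mu>\<^sub>c}"
  shows "K_U T A f \<mu> = 1 \<longleftrightarrow> deriv \<eta> \<mu> = 0"
  using \<eta>_pos[of \<mu>] assms by (auto simp: K_U_eq)

text \<open>Links the pointwise condition equivalent to \<open>K_U = 1\<close> with the global
  constancy from which the zeros are shown to be fixed.\<close>

lemma \<eta>_constant_iff:
  "(\<forall>\<mu>\<in>{0<..<\<mu>\<^sub>c}. deriv \<eta> \<mu> = 0) \<longleftrightarrow> (\<forall>\<mu>\<in>{0<..<\<mu>\<^sub>c}. \<forall>\<nu>\<in>{0<..<\<mu>\<^sub>c}. \<eta> \<mu> = \<eta> \<nu>)"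
proof safe
  fix \<mu> \<nu> assume D: "\<forall>\<mu>\<in>{0<..<\<mu>\<^sub>c}. deriv \<eta> \<mu> = 0" and *: "\<mu> \<in> {0<..<\<mu>\<^sub>c}" "\<nu> \<in> {0<..<\<mu>\<^sub>c}"
  have "(\<eta> has_real_derivative 0) (at x within {0<..<\<mu>\<^sub>c})" if "x \<in> {0<..<\<mu>\<^sub>c}" for x
    using \<eta>_differentiable[OF that] D that
    by (metis DERIV_deriv_iff_real_differentiable has_field_derivative_at_within)
  then show "\<eta> \<mu> = \<eta> \<nu>"
    using has_field_derivative_zero_constant[of "{0<..<\<mu>\<^sub>c}" \<eta>] * by (metis convex_real_interval(8))
next
  fix \<mu> assume const: "\<forall>\<mu>\<in>{0<..<\<mu>\<^sub>c}. \<forall>\<nu>\<in>{0<..<\<mu>\<^sub>c}. \<eta> \<mu> = \<eta> \<nu>" and \<mu>: "\<mu> \<in> {0<..<\<mu>\<^sub>c}"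
  have "\<forall>\<^sub>F x in nhds \<mu>. x \<in> {0<..<\<mu>\<^sub>c}"
    using \<mu> by (intro eventually_nhds_in_open) auto
  then have "\<forall>\<^sub>F x in nhds \<mu>. \<eta> x = \<eta> \<mu>"
    by eventually_elim (use const \<mu> in blast)
  then have "deriv \<eta> \<mu> = deriv (\<lambda>_. \<eta> \<mu>) \<mu>" by (rule deriv_cong_ev) simp
  then show "deriv \<eta> \<mu> = 0" by simp
qed

end

text \<open>Differentiability of \<open>log_power\<close> is asserted as well, because
  \<open>K_U\<close> is defined by \<open>deriv\<close>, which has no meaning as a derivative where
  none exists.\<close>

theorem theorem3:
  fixes T A \<mu>\<^sub>c :: real and \<phi> :: "real \<Rightarrow> real" and m :: nat and t0 :: "nat \<Rightarrow> real"
    and L :: "(real \<Rightarrow> real) \<Rightarrow> (real \<Rightarrow> real)"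
    and f :: "real \<Rightarrow> real \<Rightarrow> real" and t :: "nat \<Rightarrow> real \<Rightarrow> real"
  assumes "T > 0" and "zc_function T \<phi>" and "zero_labelling T \<phi> m t0"
    and "admissible_operator T L"
    and "\<mu>\<^sub>c > 0"
    and "\<And>\<mu> s. \<mu> \<in> {0..<\<mu>\<^sub>c} \<Longrightarrow> f \<mu> s = \<phi> s - \<mu> * L (\<lambda>x. sgn (f \<mu> x)) s"
    and "\<And>\<mu>. \<mu> \<in> {0..<\<mu>\<^sub>c} \<Longrightarrow> zc_features T \<phi> m t0 (f \<mu>) (\<lambda>k. t k \<mu>)"
    and "\<And>k. k \<in> {1..m} \<Longrightarrow> continuous_on {0..<\<mu>\<^sub>c} (t k)"
    and "\<And>k \<mu>. k \<in> {1..m} \<Longrightarrow> \<mu> \<in> {0<..<\<mu>\<^sub>c} \<Longrightarrow> t k differentiable (at \<mu>)"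
    and "\<And>k. k \<in> {1..m} \<Longrightarrow> t k 0 = t0 k"
    and "A > 0"
  shows "(\<forall>\<mu>\<in>{0<..<\<mu>\<^sub>c}. log_power T A f differentiable (at (ln (A / \<mu>))) \<and> K_U T A f \<mu> \<ge> 1) \<and>
    ((\<forall>\<mu>\<in>{0<..<\<mu>\<^sub>c}. K_U T A f \<mu> = 1) \<longleftrightarrow> (\<forall>k\<in>{1..m}. \<forall>\<mu>\<in>{0..<\<mu>\<^sub>c}. t k \<mu> = t0 k))"
proof (intro conjI ballI)
  interpret zc_branch T \<mu>\<^sub>c \<phi> m t0 L f t
    using assms(1-4,6-10) by (rule zc_branch.intro)
  fix \<mu> assume \<mu>: "\<mu> \<in> {0<..<\<mu>\<^sub>c}"
  show "log_power T A f differentiable (at (ln (A / \<mu>)))"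
    using DERIV_log_power[OF \<open>A > 0\<close> \<mu>] real_differentiable_def by blast
  have "\<mu> * deriv \<eta> \<mu> / \<eta> \<mu> \<le> 0"
    using \<mu> \<eta>_deriv_nonpos[OF \<mu>] \<eta>_pos[of \<mu>] by (auto simp: divide_le_0_iff mult_le_0_iff)
  then show "K_U T A f \<mu> \<ge> 1" using K_U_eq[OF \<open>A > 0\<close> \<mu>] by simp
next
  interpret zc_branch T \<mu>\<^sub>c \<phi> m t0 L f t
    using assms(1-4,6-10) by (rule zc_branch.intro)
  have "(\<forall>\<mu>\<in>{0<..<\<mu>\<^sub>c}. K_U T A f \<mu> = 1) \<longleftrightarrow> (\<forall>\<mu>\<in>{0<..<\<mu>\<^sub>c}. \<forall>\<nu>\<in>{0<..<\<mu>\<^sub>c}. \<eta> \<mu> = \<eta> \<nu>)"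
    using K_U_eq_1_iff[OF \<open>A > 0\<close>] \<eta>_constant_iff by simp
  also have "\<dots> \<longleftrightarrow> (\<forall>k\<in>{1..m}. \<forall>\<mu>\<in>{0..<\<mu>\<^sub>c}. t k \<mu> = t0 k)"
  proof
    assume "\<forall>\<mu>\<in>{0<..<\<mu>\<^sub>c}. \<forall>\<nu>\<in>{0<..<\<mu>\<^sub>c}. \<eta> \<mu> = \<eta> \<nu>"
    then show "\<forall>k\<in>{1..m}. \<forall>\<mu>\<in>{0..<\<mu>\<^sub>c}. t k \<mu> = t0 k"
      by (intro ballI t_constant_if_\<eta>_constant) blast+
  next
    assume "\<forall>k\<in>{1..m}. \<forall>\<mu>\<in>{0..<\<mu>\<^sub>c}. t k \<mu> = t0 k"
    then show "\<forall>\<mu>\<in>{0<..<\<mu>\<^sub>c}. \<forall>\<nu>\<in>{0<..<\<mu>\<^sub>c}. \<eta> \<mu> = \<eta> \<nu>"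
      by (intro ballI \<eta>_constant_if_t_constant) auto
  qed
  finally show "(\<forall>\<mu>\<in>{0<..<\<mu>\<^sub>c}. K_U T A f \<mu> = 1) \<longleftrightarrow> (\<forall>k\<in>{1..m}. \<forall>\<mu>\<in>{0..<\<mu>\<^sub>c}. t k \<mu> = t0 k)" .
qed

end
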